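(* Given vectors $\tilde{\mathbf Q}_{ij}\in\mathbb R^{N_v^3}$, $i,j\in\mathcal S$, consider the constrained optimization problem for elastic collisions $$\mathcal P^{\rm el}:\quad \min_{(\mathbf Q_{ij})_{i,j\in\mathcal S}}\ \sum_{i,j\in\mathcal S}\left|\tilde{\mathbf Q}_{ij}-\mathbf Q_{ij}\right|^2\quad\text{subject to}\quad\sum_{i,j\in\mathcal S}\mathbf C_i^{\rm el}\,\mathbf Q_{ij}=\mathbf 0\in\mathbb R^{N_s+4},$$ over vectors $\mathbf Q_{ij}\in\mathbb R^{N_v^3}$. The solution of $\mathcal P^{\rm el}$ is $$\mathbf Q_{ij}=\tilde{\mathbf Q}_{ij}-(\mathbf C_i^{\rm el})^{\mathrm T}\,\mathbf A^{-1}\,\mathbf b,\qquad i,j\in\mathcal S,$$ where $$\mathbf A=N_s\sum_{i\in\mathcal S}\mathbf C_i^{\rm el}(\mathbf C_i^{\rm el})^{\mathrm T},\qquad \mathbf b=\sum_{i,j\in\mathcal S}\mathbf C_i^{\rm el}\,\tilde{\mathbf Q}_{ij}.$$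
   Context: $\mathcal S=\{1,\dots,N_s\}$ indexes species; species $i$ has mass $m_i$. The velocity space is discretized by $N_v^3$ nodes $\mathbf v_{\mathbf k}=-L_v(1,1,1)+\mathbf k\,\Delta v$, $\mathbf k=(k_x,k_y,k_z)\in\{0,\dots,N_v-1\}^3$, where $L_v$ is the semi-length of the velocity cube and $\Delta v=2L_v/N_v$. Each node has a global integration weight $w_{\mathbf k}=w_{k_x}w_{k_y}w_{k_z}$. A vector in $\mathbb R^{N_v^3}$ has components indexed by the nodes $\mathbf k$: $\mathbf Q_{ij}$ and $\tilde{\mathbf Q}_{ij}$ store the node values of the partial elastic collision operator for the collision $i+j=i+j$, the tilde denoting values (obtained by inverting a Fourier transform) that do not satisfy conservation. $|\cdot|$ is the Euclidean norm and $\mathrm T$ denotes the transpose. The elastic integration matrix $\mathbf C_i^{\rm el}$ is the real $(N_s+4)\times N_v^3$ matrix whose column associated with node $\mathbf k$ is $$(\mathbf C_i^{\rm el})_{\mathbf k}=(\Delta v)^3\,w_{\mathbf k}\left[\,m_i\boldsymbol\delta_i,\ m_i\mathbf v_{\mathbf k},\ \tfrac12 m_i|\mathbf v_{\mathbf k}|^2\,\right]^{\mathrm T},$$ where $\boldsymbol\delta_i\in\mathbb R^{N_s}$ has $j$-th component equal to the Kronecker delta $\delta_{ij}$. *)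

theory Defs
  imports "HOL-Analysis.Analysis"
begin

text \<open>
  Encoding.  Species are the elements of a finite type \<open>'s\<close>, so \<open>N\<^sub>s = CARD('s)\<close>.  The index set
  \<open>{0,\<dots>,N\<^sub>v - 1}\<close> of the nodes in one direction is a finite linearly ordered type \<open>'n\<close>, so
  \<open>N\<^sub>v = CARD('n)\<close>; \<open>node_index\<close> recovers the integer.  A node multi-index is a \<open>k :: 'n^3\<close>, and
  \<open>'n^3\<close> has exactly \<open>N\<^sub>v ^ 3\<close> elements.  The \<open>N\<^sub>s + 4\<close> rows of the integration matrix are indexed by
  \<open>'s + 3 + 1\<close> (mass of each species, three momentum components, energy).
\<close>

definition node_index :: "'n::{finite,linorder} \<Rightarrow> nat"
  where "node_index a = card {..<a}"

definition delta_v :: "'n itself \<Rightarrow> real \<Rightarrow> real"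
  where "delta_v _ Lv = 2 * Lv / real CARD('n)"

definition vel :: "real \<Rightarrow> 'n::{finite,linorder}^3 \<Rightarrow> real^3"
  where "vel Lv k = - Lv *\<^sub>R 1 + delta_v TYPE('n) Lv *\<^sub>R (\<chi> a. real (node_index (k $ a)))"

definition weight :: "('n \<Rightarrow> real) \<Rightarrow> 'n^3 \<Rightarrow> real"
  where "weight w k = w (k $ 1) * w (k $ 2) * w (k $ 3)"

definition C_el_column ::
    "('s::finite \<Rightarrow> real) \<Rightarrow> ('n::{finite,linorder} \<Rightarrow> real) \<Rightarrow> real \<Rightarrow> 's \<Rightarrow> 'n^3 \<Rightarrow> real^('s + 3 + 1)"
  where "C_el_column m w Lv i k =
    ((delta_v TYPE('n) Lv) ^ 3 * weight w k) *\<^sub>R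
      (\<chi> r. case r of
          Inl j \<Rightarrow> m i * (if i = j then 1 else 0)
        | Inr (Inl a) \<Rightarrow> m i * (vel Lv k $ a)
        | Inr (Inr _) \<Rightarrow> 1 / 2 * m i * (norm (vel Lv k))\<^sup>2)"

definition C_el ::
    "('s::finite \<Rightarrow> real) \<Rightarrow> ('n::{finite,linorder} \<Rightarrow> real) \<Rightarrow> real \<Rightarrow> 's \<Rightarrow> real^('n^3)^('s + 3 + 1)"
  where "C_el m w Lv i = (\<chi> r k. C_el_column m w Lv i k $ r)"

definition P_el_objective ::
    "('s::finite \<Rightarrow> 's \<Rightarrow> real^('n::finite^3)) \<Rightarrow> ('s \<Rightarrow> 's \<Rightarrow> real^('n^3)) \<Rightarrow> real"
  where "P_el_objective Qt Q = (\<Sum>i\<in>UNIV. \<Sum>j\<in>UNIV. (norm (Qt i j - Q i j))\<^sup>2)"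

definition P_el_feasible ::
    "('s::finite \<Rightarrow> real) \<Rightarrow> ('n::{finite,linorder} \<Rightarrow> real) \<Rightarrow> real \<Rightarrow> ('s \<Rightarrow> 's \<Rightarrow> real^('n^3)) \<Rightarrow> bool"
  where "P_el_feasible m w Lv Q \<longleftrightarrow> (\<Sum>i\<in>UNIV. \<Sum>j\<in>UNIV. C_el m w Lv i *v Q i j) = 0"

definition A_el ::
    "('s::finite \<Rightarrow> real) \<Rightarrow> ('n::{finite,linorder} \<Rightarrow> real) \<Rightarrow> real \<Rightarrow> real^('s + 3 + 1)^('s + 3 + 1)"
  where "A_el m w Lv =
    real CARD('s) *\<^sub>R (\<Sum>i\<in>UNIV. C_el m w Lv i ** transpose (C_el m w Lv i))"

definition b_el ::
    "('s::finite \<Rightarrow> real) \<Rightarrow> ('n::{finite,linorder} \<Rightarrow> real) \<Rightarrow> real \<Rightarrow> ('s \<Rightarrow> 's \<Rightarrow> real^('n^3))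
      \<Rightarrow> real^('s + 3 + 1)"
  where "b_el m w Lv Qt = (\<Sum>i\<in>UNIV. \<Sum>j\<in>UNIV. C_el m w Lv i *v Qt i j)"

lemma A_el_kernel:
  fixes m :: "'s::finite \<Rightarrow> real" and w :: "'n::{finite,linorder} \<Rightarrow> real"
  assumes "A_el m w Lv *v y = 0"
  shows "transpose (C_el m w Lv i) *v y = 0"
proof -
  have "A_el m w Lv *v y = real CARD('s) *\<^sub>R
      (\<Sum>i\<in>UNIV. C_el m w Lv i *v (transpose (C_el m w Lv i) *v y))"
  proof -
    have "(\<Sum>i\<in>S. C_el m w Lv i ** transpose (C_el m w Lv i)) *v y =
      (\<Sum>i\<in>S. C_el m w Lv i *v (transpose (C_el m w Lv i) *v y))" if "finite S" for S :: "'s set"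
      using that
      by induction (simp_all add: matrix_vector_mult_add_rdistrib matrix_vector_mul_assoc
            del: transpose_matrix_vector)
    then show ?thesis
      by (simp add: A_el_def scaleR_matrix_vector_assoc[symmetric])
  qed
  with assms have "0 = y \<bullet> (\<Sum>i\<in>UNIV. C_el m w Lv i *v (transpose (C_el m w Lv i) *v y))"
    by simp
  also have "\<dots> = (\<Sum>i\<in>UNIV. (norm (transpose (C_el m w Lv i) *v y))\<^sup>2)"
    by (simp add: inner_sum_right dot_lmul_matrix[symmetric] power2_norm_eq_inner)
  finally have "(\<Sum>i\<in>UNIV. (norm (transpose (C_el m w Lv i) *v y))\<^sup>2) = 0" ..
  then show ?thesis
    by (simp add: sum_nonneg_eq_0_iff)
qed

lemma strict_mono_node_index: "strict_mono (node_index :: 'n::{finite,linorder} \<Rightarrow> nat)"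
  unfolding node_index_def by (intro strict_monoI psubset_card_mono) auto

lemma quadratic_three_zeros:
  fixes p e c :: real
  assumes "\<And>x. x \<in> {s, t, u} \<Longrightarrow> c + x * p + x\<^sup>2 * e = 0" and "s \<noteq> t" "t \<noteq> u" "s \<noteq> u"
  shows "p = 0 \<and> e = 0"
proof -
  have s: "c + s * p + s\<^sup>2 * e = 0" and t: "c + t * p + t\<^sup>2 * e = 0" and u: "c + u * p + u\<^sup>2 * e = 0"
    using assms(1) by auto
  have "(s - t) * (p + (s + t) * e) = 0" "(t - u) * (p + (t + u) * e) = 0"
    using s t u by (simp_all add: algebra_simps power2_eq_square)
  with assms have 1: "p + (s + t) * e = 0" "p + (t + u) * e = 0" by auto
  have "(s - u) * e = (p + (s + t) * e) - (p + (t + u) * e)" by (simp add: algebra_simps)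
  with 1 have "(s - u) * e = 0" by simp
  with assms 1 show ?thesis by auto
qed

text \<open>
  \<open>A\<^sup>-\<^sup>1\<close> exists in the intended setting.  At least three nodes per direction are needed: with two of
  them \<open>|v|\<^sup>2\<close> is an affine function of \<open>v\<close> on the grid, and \<open>A\<close> is singular.
\<close>

lemma invertible_A_el:
  fixes m :: "'s::finite \<Rightarrow> real" and w :: "'n::{finite,linorder} \<Rightarrow> real"
  assumes m: "\<And>i. m i > 0" and w: "\<And>a. w a \<noteq> 0" and Lv: "Lv > 0" and card: "CARD('n) \<ge> 3"
  shows "invertible (A_el m w Lv)"
proof -
  have "y = 0" if A: "A_el m w Lv *v y = 0" for y
  proof -
    define d where "d = delta_v TYPE('n) Lv"
    have d: "d > 0" using Lv by (simp add: d_def delta_v_def)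
    define p where "p a = y $ Inr (Inl a)" for a
    define e where "e = y $ Inr (Inr 1) / 2"
    have vel: "vel Lv k $ a = - Lv + d * real (node_index (k $ a))" for k :: "'n^3" and a
      by (simp add: vel_def d_def)
    have eq: "y $ Inl i + (\<Sum>a\<in>UNIV. vel Lv k $ a * p a + (vel Lv k $ a)\<^sup>2 * e) = 0"
      for i and k :: "'n^3"
    proof -
      have "0 = (transpose (C_el m w Lv i) *v y) $ k"
        using A_el_kernel[OF A] by simp
      also have "\<dots> = (\<Sum>r\<in>UNIV. C_el_column m w Lv i k $ r * y $ r)"
        by (simp add: matrix_vector_mult_def transpose_def C_el_def)
      also have "\<dots> = (\<Sum>j\<in>UNIV. C_el_column m w Lv i k $ Inl j * y $ Inl j)
          + (\<Sum>a\<in>UNIV. C_el_column m w Lv i k $ Inr (Inl a) * y $ Inr (Inl a))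
          + C_el_column m w Lv i k $ Inr (Inr 1) * y $ Inr (Inr 1)"
        by (simp add: UNIV_Plus_UNIV[symmetric] sum.Plus del: UNIV_Plus_UNIV)
      also have "\<dots> = d ^ 3 * weight w k * m i *
          (y $ Inl i + (\<Sum>a\<in>UNIV. vel Lv k $ a * p a) + (norm (vel Lv k))\<^sup>2 * e)"
        by (simp add: C_el_column_def d_def[symmetric] p_def e_def algebra_simps sum_distrib_left
            if_distrib[where f="\<lambda>x. _ * x"] if_distrib[where f="\<lambda>x. x * _"] cong: if_cong)
      also have "(norm (vel Lv k))\<^sup>2 * e = (\<Sum>a\<in>UNIV. (vel Lv k $ a)\<^sup>2 * e)"
        unfolding power2_norm_eq_inner inner_vec_def by (simp add: power2_eq_square sum_distrib_right)
      finally show ?thesis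
        using d m[of i] w by (simp add: weight_def sum.distrib add.assoc)
    qed
    obtain T :: "'n set" where T: "card T = 3"
      using obtain_subset_with_card_n[OF card] by metis
    then obtain n0 n1 n2 :: 'n where n: "n0 \<noteq> n1" "n1 \<noteq> n2" "n0 \<noteq> n2"
      unfolding card_3_iff by blast
    define g where "g n = - Lv + d * real (node_index n)" for n :: 'n
    have inj: "g a = g b \<longleftrightarrow> a = b" for a b
      using d strict_mono_eq[OF strict_mono_node_index] by (auto simp: g_def)
    have pe: "p a = 0 \<and> e = 0" for a
    proof -
      obtain i :: 's where True by blast
      define c where "c = y $ Inl i + (\<Sum>b\<in>UNIV - {a}. g n0 * p b + (g n0)\<^sup>2 * e)"
      have "c + g n * p a + (g n)\<^sup>2 * e = 0" for n
      proof -
        have "0 = y $ Inl i + (\<Sum>b\<in>UNIV. g (if b = a then n else n0) * p b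
            + (g (if b = a then n else n0))\<^sup>2 * e)"
          using eq[of i "\<chi> b. if b = a then n else n0"] by (simp add: vel g_def)
        also have "\<dots> = c + g n * p a + (g n)\<^sup>2 * e"
          unfolding c_def by (subst sum.remove[of _ a]) auto
        finally show ?thesis by simp
      qed
      then show ?thesis
        using n by (intro quadratic_three_zeros[of "g n0" "g n1" "g n2" c]) (auto simp: inj)
    qed
    then have "y $ Inl i = 0" for i using eq[of i undefined] by simp
    moreover have "y $ Inr (Inl a) = 0" for a using pe p_def by metis
    moreover have "y $ Inr (Inr u) = 0" for u :: 1
      using pe e_def by (subst num1_eq1[of u]) simp
    ultimately have "y $ r = 0" for r
      by (metis sum.exhaust)
    then show "y = 0" by (simp add: vec_eq_iff)
  qed
  then show ?thesis
    by (simp add: invertible_left_inverse matrix_left_invertible_ker)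
qed

end

(* Put l = A^-1 b and q_ij = Qt_ij - C_i^T l.  Then q is feasible because sum_ij C_i C_i^T l = A l = b.
   The residual Qt - q = C^T l is orthogonal to the kernel of the constraint map, so Pythagoras gives
   objective Q = objective q + sum_ij |q_ij - Q_ij|^2 for every feasible Q, and q is the only minimizer. *)
theory Submission
  imports Defs
begin

text \<open>The inner summand does not depend on \<open>j\<close>, so summing over \<open>j\<close>
  yields the factor \<open>CARD('s)\<close> of \<open>A_el\<close>. The double sum has the shape of
  the constraint.\<close>

lemma A_el_mult_vec:
  fixes m :: "'s::finite \<Rightarrow> real" and w :: "'n::{finite,linorder} \<Rightarrow> real"
  shows "A_el m w Lv *v y =
    (\<Sum>i\<in>UNIV. \<Sum>j\<in>(UNIV :: 's set). C_el m w Lv i *v (transpose (C_el m w Lv i) *v y))"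
proof -
  have "(\<Sum>i\<in>S. C_el m w Lv i ** transpose (C_el m w Lv i)) *v y =
      (\<Sum>i\<in>S. C_el m w Lv i *v (transpose (C_el m w Lv i) *v y))" if "finite S" for S :: "'s set"
    using that
    by induction (simp_all add: matrix_vector_mult_add_rdistrib matrix_vector_mul_assoc
        del: transpose_matrix_vector)
  then show ?thesis
    by (simp add: A_el_def scaleR_matrix_vector_assoc[symmetric] sum_constant_scaleR
        scaleR_sum_right[symmetric] del: transpose_matrix_vector sum_constant)
qed

text \<open>The constraint map is linear: the shift lowers its value from \<open>b_el\<close> by
  \<open>A_el *v y\<close>. Feasibility thus becomes a linear system for \<open>y\<close>.\<close>

lemma P_el_feasible_shift:
  fixes m :: "'s::finite \<Rightarrow> real" and w :: "'n::{finite,linorder} \<Rightarrow> real"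
  shows "P_el_feasible m w Lv (\<lambda>i j. Qt i j - transpose (C_el m w Lv i) *v y) \<longleftrightarrow>
    A_el m w Lv *v y = b_el m w Lv Qt"
  by (auto simp: P_el_feasible_def A_el_mult_vec b_el_def matrix_vector_mult_diff_distrib
      sum_subtractf simp del: transpose_matrix_vector)

lemma P_el_objective_pythagoras:
  fixes m :: "'s::finite \<Rightarrow> real" and w :: "'n::{finite,linorder} \<Rightarrow> real"
  assumes q: "\<And>i j. q i j = Qt i j - transpose (C_el m w Lv i) *v y"
    and "P_el_feasible m w Lv q" "P_el_feasible m w Lv Q"
  shows "P_el_objective Qt Q = P_el_objective Qt q + P_el_objective q Q"
proof -
  \<comment> \<open>The cross term of a single pair need not vanish, so it is kept, with
    \<open>C_el\<close> moved by adjointness onto \<open>q\<close> and \<open>Q\<close>.\<close>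
  have "(norm (Qt i j - Q i j))\<^sup>2 = (norm (Qt i j - q i j))\<^sup>2 + (norm (q i j - Q i j))\<^sup>2
      + 2 * (y \<bullet> (C_el m w Lv i *v q i j) - y \<bullet> (C_el m w Lv i *v Q i j))" for i j
  proof -
    \<comment> \<open>\<open>y v* C_el m w Lv i\<close> is the simp normal form of the transposed
      product, and the form that \<open>dot_lmul_matrix\<close> expects.\<close>
    have "Qt i j - Q i j = y v* C_el m w Lv i + (q i j - Q i j)" "Qt i j - q i j = y v* C_el m w Lv i"
      by (simp_all add: q)
    moreover have "(y v* C_el m w Lv i) \<bullet> (q i j - Q i j) =
        y \<bullet> (C_el m w Lv i *v q i j) - y \<bullet> (C_el m w Lv i *v Q i j)"
      by (simp add: dot_lmul_matrix inner_diff_right)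
    moreover have "(norm (u + d))\<^sup>2 = (norm u)\<^sup>2 + (norm d)\<^sup>2 + 2 * (u \<bullet> d)" for u d :: "real^('n^3)"
      by (simp add: power2_norm_eq_inner inner_add_left inner_add_right inner_commute)
    ultimately show ?thesis
      by (simp only:)
  qed
  \<comment> \<open>After summation over all pairs, \<open>y\<close> is paired with the constraint
    values of \<open>q\<close> and \<open>Q\<close>, both zero by feasibility.\<close>
  then have "P_el_objective Qt Q = P_el_objective Qt q + P_el_objective q Q
      + 2 * (y \<bullet> (\<Sum>i\<in>UNIV. \<Sum>j\<in>UNIV. C_el m w Lv i *v q i j)
           - y \<bullet> (\<Sum>i\<in>UNIV. \<Sum>j\<in>UNIV. C_el m w Lv i *v Q i j))"
    by (simp add: P_el_objective_def sum.distrib sum_distrib_left[symmetric] sum_subtractf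
        inner_sum_right)
  with assms(2,3) show ?thesis
    by (simp add: P_el_feasible_def)
qed

lemma P_el_objective_nonneg: "P_el_objective q Q \<ge> 0"
  by (simp add: P_el_objective_def sum_nonneg)

lemma P_el_objective_eq_0_iff: "P_el_objective q Q = 0 \<longleftrightarrow> (\<forall>i j. Q i j = q i j)"
  by (auto simp: P_el_objective_def sum_nonneg_eq_0_iff sum_nonneg)

theorem proposition4p1:
  fixes m :: "'s::finite \<Rightarrow> real"
    and w :: "'n::{finite,linorder} \<Rightarrow> real"
    and Lv :: real
    and Qt Q :: "'s \<Rightarrow> 's \<Rightarrow> real^('n^3)"
  assumes "invertible (A_el m w Lv)"
  shows "is_arg_min (P_el_objective Qt) (P_el_feasible m w Lv) Q \<longleftrightarrow>
    (\<forall>i j. Q i j =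
      Qt i j - transpose (C_el m w Lv i) *v (matrix_inv (A_el m w Lv) *v b_el m w Lv Qt))"
proof -
  \<comment> \<open>Up to a factor 2, this is the Lagrange multiplier of the constraint.\<close>
  define y where "y = matrix_inv (A_el m w Lv) *v b_el m w Lv Qt"
  define q where "q i j = Qt i j - transpose (C_el m w Lv i) *v y" for i j
  \<comment> \<open>\<open>matrix_inv\<close> chooses a two-sided inverse by \<open>SOME\<close>;
    invertibility supplies a witness. The right-inverse half solves the system for
    \<open>y\<close>.\<close>
  have inverse: "A_el m w Lv ** matrix_inv (A_el m w Lv) = mat 1"
    using assms unfolding invertible_def matrix_inv_def by (rule someI2_ex) simp
  have "A_el m w Lv *v y = b_el m w Lv Qt"
    by (simp add: y_def matrix_vector_mul_assoc inverse)
  then have feasible: "P_el_feasible m w Lv q"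
    unfolding q_def P_el_feasible_shift .
  have pyth: "P_el_objective Qt R = P_el_objective Qt q + P_el_objective q R"
    if "P_el_feasible m w Lv R" for R
    using P_el_objective_pythagoras[OF q_def feasible that] .
  have "is_arg_min (P_el_objective Qt) (P_el_feasible m w Lv) Q \<longleftrightarrow> (\<forall>i j. Q i j = q i j)"
  proof
    assume "is_arg_min (P_el_objective Qt) (P_el_feasible m w Lv) Q"
    then have "P_el_feasible m w Lv Q" "P_el_objective Qt Q \<le> P_el_objective Qt q"
      using feasible by (auto simp: is_arg_min_def not_less)
    \<comment> \<open>Since \<open>Q\<close> does no worse than the feasible \<open>q\<close>,
      \<open>pyth\<close> leaves no room for a positive distance between them.\<close>
    then have "P_el_objective q Q = 0"
      using pyth[of Q] P_el_objective_nonneg[of q Q] by simp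
    then show "\<forall>i j. Q i j = q i j"
      by (simp add: P_el_objective_eq_0_iff)
  next
    assume "\<forall>i j. Q i j = q i j"
    then have "Q = q" by blast
    moreover have "P_el_objective Qt q \<le> P_el_objective Qt R" if "P_el_feasible m w Lv R" for R
      using pyth[OF that] P_el_objective_nonneg[of q R] by linarith
    ultimately show "is_arg_min (P_el_objective Qt) (P_el_feasible m w Lv) Q"
      using feasible by (auto simp: is_arg_min_def not_less)
  qed
  then show ?thesis
    by (simp only: q_def y_def)
qed

end
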